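(* Every ascent sequence avoiding the pattern $0101$ (equivalently, $101$) is a restricted growth function, and for each $n\ge1$ the ascent sequences of length $n$ avoiding $0101$ are precisely the restricted growth functions encoding the non-crossing set partitions of $\{1,\ldots,n\}$; that is, the encoding of set partitions by restricted growth functions restricts to a bijection between $0101$-avoiding ascent sequences of length $n$ and non-crossing partitions of $\{1,\ldots,n\}$.
   Context: An ascent sequence is a finite sequence $x_1x_2\ldots x_n$ of nonnegative integers with $x_1=0$ and $x_i\le \operatorname{asc}(x_1\ldots x_{i-1})+1$ for all $1<i\le n$, where $\operatorname{asc}(y_1\ldots y_k)$ is the number of indices $j$ with $y_j<y_{j+1}$. An occurrence of a pattern $p=p_1\ldots p_k$ (a word over nonnegative integers) in $x_1\ldots x_n$ is a subsequence $x_{i_1}\ldots x_{i_k}$, $i_1<\cdots<i_k$, with $x_{i_a}<x_{i_b}$ iff $p_a<p_b$ and $x_{i_a}=x_{i_b}$ iff $p_a=p_b$; a sequence avoids $p$ if it has no occurrence. A set partition of $\{1,\ldots,n\}$ is encoded as follows: order its blocks by increasing minima and number them $0,1,2,\ldots$; the encoding is $a_1\ldots a_n$ where $a_i$ is the number of the block containing $i$. The strings arising this way are exactly the restricted growth functions (RGFs): strings of nonnegative integers starting with $0$ in which the first occurrence of each letter $k>0$ is preceded by an occurrence of $k-1$. A partition is non-crossing if there are no $a<b<c<d$ with $a,c$ in one block and $b,d$ in a different block. *)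

theory Defs
  imports Main "HOL-Library.Sublist" "HOL-Library.Disjoint_Sets"
begin

text \<open>Words are 0-indexed lists: the letter \<open>x\<^sub>i\<close> of a word is \<open>xs ! (i - 1)\<close>.\<close>

definition asc :: "nat list \<Rightarrow> nat" where
  "asc xs = card {j. Suc j < length xs \<and> xs ! j < xs ! Suc j}"

definition ascent_seq :: "nat list \<Rightarrow> bool" where
  "ascent_seq xs \<longleftrightarrow> xs \<noteq> [] \<and> xs ! 0 = 0 \<and>
     (\<forall>i. 0 < i \<and> i < length xs \<longrightarrow> xs ! i \<le> asc (take i xs) + 1)"

definition order_isomorphic :: "nat list \<Rightarrow> nat list \<Rightarrow> bool" where
  "order_isomorphic ys p \<longleftrightarrow> length ys = length p \<and>
     (\<forall>a < length p. \<forall>b < length p.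
        (ys ! a < ys ! b \<longleftrightarrow> p ! a < p ! b) \<and> (ys ! a = ys ! b \<longleftrightarrow> p ! a = p ! b))"

text \<open>\<^const>\<open>subseq\<close> is the library's (not necessarily contiguous) subsequence relation.\<close>

definition avoids :: "nat list \<Rightarrow> nat list \<Rightarrow> bool" where
  "avoids xs p \<longleftrightarrow> \<not> (\<exists>ys. subseq ys xs \<and> order_isomorphic ys p)"

text \<open>The premise on \<open>i\<close> says that position \<open>i\<close> is the first occurrence of a positive letter.\<close>

definition rgf :: "nat list \<Rightarrow> bool" where
  "rgf xs \<longleftrightarrow> xs \<noteq> [] \<and> xs ! 0 = 0 \<and>
     (\<forall>i < length xs. 0 < xs ! i \<and> (\<forall>j < i. xs ! j \<noteq> xs ! i)
        \<longrightarrow> (\<exists>j < i. xs ! j = xs ! i - 1))"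

text \<open>Numbering the blocks \<open>0, 1, 2, \<dots>\<close> by increasing minima gives each block the number
  of blocks with a smaller minimum.\<close>

definition block_number :: "nat set set \<Rightarrow> nat set \<Rightarrow> nat" where
  "block_number P B = card {C \<in> P. Min C < Min B}"

definition encode :: "nat \<Rightarrow> nat set set \<Rightarrow> nat list" where
  "encode n P = map (\<lambda>i. block_number P (THE B. B \<in> P \<and> i \<in> B)) [1..<Suc n]"

definition noncrossing :: "nat set set \<Rightarrow> bool" where
  "noncrossing P \<longleftrightarrow> \<not> (\<exists>B \<in> P. \<exists>C \<in> P. B \<noteq> C \<and>
     (\<exists>a b c d. a < b \<and> b < c \<and> c < d \<and> a \<in> B \<and> c \<in> B \<and> b \<in> C \<and> d \<in> C))"

definition noncrossing_partitions :: "nat \<Rightarrow> nat set set set" where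
  "noncrossing_partitions n = {P. partition_on {1..n} P \<and> noncrossing P}"

end

theory Submission
  imports Defs
begin

text \<open>In a restricted growth function every letter is preceded by all smaller letters. Hence every
  letter below the maximum is the top of an ascent, so restricted growth functions are ascent
  sequences, and every occurrence of 101 extends to one of 0101. Conversely, if a prefix of an
  ascent sequence is a restricted growth function avoiding 101, then its ascent tops are distinct,
  so there are at most as many ascents as positive letters, and the next letter exceeds the maximum
  by at most one. Finally, a crossing of two blocks reads 0101 or 1010 in the encoding, and the
  latter also gives 0101 since the smaller letter already occurs before the first 1.\<close>

section \<open>Patterns in terms of positions\<close>

text \<open>The form with \<open>drop m xs\<close> reproduces itself on the right-hand side.
  Repeated unfolding thus turns a pattern of fixed length into a chain of increasing positions of
  \<open>xs\<close> itself.\<close>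

lemma subseq_Cons_drop_iff:
  "subseq (y # ys) (drop m xs) \<longleftrightarrow>
     (\<exists>i\<ge>m. i < length xs \<and> xs ! i = y \<and> subseq ys (drop (Suc i) xs))"
proof
  assume "subseq (y # ys) (drop m xs)"
  \<comment> \<open>\<open>us\<close> is the part skipped before \<open>y\<close> is matched, so
    \<open>y\<close> stands at position \<open>m + length us\<close> of \<open>xs\<close>.\<close>
  then obtain us vs where split: "drop m xs = us @ y # vs" and vs: "subseq ys vs"
    using list_emb_ConsD[of "(=)" y ys] by metis
  have len: "length xs - m = length us + Suc (length vs)"
    using arg_cong[OF split, of length] by simp
  have "xs ! (m + length us) = y"
    using arg_cong[OF split, of "\<lambda>l. l ! length us"] len by simp
  moreover have "drop (Suc (m + length us)) xs = vs"
    using arg_cong[OF split, of "drop (Suc (length us))"] by (simp add: add.commute)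
  ultimately show "\<exists>i\<ge>m. i < length xs \<and> xs ! i = y \<and> subseq ys (drop (Suc i) xs)"
    using vs len by (intro exI[of _ "m + length us"]) auto
next
  assume "\<exists>i\<ge>m. i < length xs \<and> xs ! i = y \<and> subseq ys (drop (Suc i) xs)"
  then obtain i where i: "m \<le> i" "i < length xs" "xs ! i = y" "subseq ys (drop (Suc i) xs)"
    by blast
  then have "subseq (y # ys) (drop i xs)"
    by (metis Cons_nth_drop_Suc subseq_Cons2)
  moreover have "suffix (drop i xs) (drop m xs)"
    using i(1) by (metis drop_drop le_add_diff_inverse2 suffix_drop)
  ultimately show "subseq (y # ys) (drop m xs)"
    using suffix_imp_subseq subseq_order.trans by blast
qed

lemma subseq_Cons_iff:
  "subseq (y # ys) xs \<longleftrightarrow> (\<exists>i<length xs. xs ! i = y \<and> subseq ys (drop (Suc i) xs))"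
  using subseq_Cons_drop_iff[of y ys 0 xs] by simp

lemma subseq_3_iff:
  "subseq [a, b, c] xs \<longleftrightarrow>
     (\<exists>i j k. i < j \<and> j < k \<and> k < length xs \<and> xs ! i = a \<and> xs ! j = b \<and> xs ! k = c)"
  (is "?L \<longleftrightarrow> ?R")
proof -
  have iff: "?L \<longleftrightarrow> (\<exists>i<length xs. xs ! i = a \<and> (\<exists>j>i. j < length xs \<and> xs ! j = b \<and>
      (\<exists>k>j. k < length xs \<and> xs ! k = c)))"
    unfolding subseq_Cons_iff[of a "[b, c]"] subseq_Cons_drop_iff Suc_le_eq by simp
  show ?thesis
  proof
    assume ?R
    then obtain i j k where ord: "i < j" "j < k" "k < length xs"
      and val: "xs ! i = a" "xs ! j = b" "xs ! k = c"
      by blast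
    have "i < length xs" "j < length xs" using ord by auto
    then show ?L unfolding iff using ord val by blast
  qed (unfold iff, blast)
qed

lemma subseq_4_iff:
  "subseq [a, b, c, d] xs \<longleftrightarrow>
     (\<exists>i j k l. i < j \<and> j < k \<and> k < l \<and> l < length xs \<and>
        xs ! i = a \<and> xs ! j = b \<and> xs ! k = c \<and> xs ! l = d)"
  (is "?L \<longleftrightarrow> ?R")
proof -
  have iff: "?L \<longleftrightarrow> (\<exists>i<length xs. xs ! i = a \<and> (\<exists>j>i. j < length xs \<and> xs ! j = b \<and>
      (\<exists>k>j. k < length xs \<and> xs ! k = c \<and> (\<exists>l>k. l < length xs \<and> xs ! l = d))))"
    unfolding subseq_Cons_iff[of a "[b, c, d]"] subseq_Cons_drop_iff Suc_le_eq by simp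
  show ?thesis
  proof
    assume ?R
    then obtain i j k l where ord: "i < j" "j < k" "k < l" "l < length xs"
      and val: "xs ! i = a" "xs ! j = b" "xs ! k = c" "xs ! l = d"
      by blast
    have "i < length xs" "j < length xs" "k < length xs" using ord by auto
    then show ?L unfolding iff using ord val by blast
  qed (unfold iff, blast)
qed

lemma avoids_101_iff:
  "avoids xs [1,0,1] \<longleftrightarrow>
     \<not> (\<exists>i j k. i < j \<and> j < k \<and> k < length xs \<and> xs ! j < xs ! i \<and> xs ! k = xs ! i)"
proof -
  have iso: "order_isomorphic ys [1,0,1] \<longleftrightarrow> (\<exists>a b. ys = [a, b, a] \<and> b < a)" for ys
    by (auto simp: order_isomorphic_def length_Suc_conv All_less_Suc numeral_3_eq_3 numeral_2_eq_2)
  have "avoids xs [1,0,1] \<longleftrightarrow> \<not> (\<exists>a b. subseq [a, b, a] xs \<and> b < a)"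
    unfolding avoids_def iso by blast
  then show ?thesis unfolding subseq_3_iff by blast
qed

lemma avoids_0101_iff:
  "avoids xs [0,1,0,1] \<longleftrightarrow>
     \<not> (\<exists>i j k l. i < j \<and> j < k \<and> k < l \<and> l < length xs \<and>
          xs ! i < xs ! j \<and> xs ! k = xs ! i \<and> xs ! l = xs ! j)"
proof -
  have iso: "order_isomorphic ys [0,1,0,1] \<longleftrightarrow> (\<exists>a b. ys = [a, b, a, b] \<and> a < b)" for ys
    by (auto simp: order_isomorphic_def length_Suc_conv All_less_Suc numeral_3_eq_3 numeral_2_eq_2)
  have "avoids xs [0,1,0,1] \<longleftrightarrow> \<not> (\<exists>a b. subseq [a, b, a, b] xs \<and> a < b)"
    unfolding avoids_def iso by blast
  then show ?thesis unfolding subseq_4_iff by blast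
qed

section \<open>Ascent sequences and restricted growth functions\<close>

text \<open>Strong induction on the position. A repeated letter is traced to an earlier occurrence;
  at a first occurrence of a positive letter its predecessor value occurs earlier, and the induction
  continues from there. This form, free of first occurrences, is the one used below.\<close>

lemma rgf_iff_smaller_letters_before:
  "rgf xs \<longleftrightarrow> xs \<noteq> [] \<and> (\<forall>i<length xs. \<forall>v<xs ! i. \<exists>j<i. xs ! j = v)"
proof
  assume rgf: "rgf xs"
  have "\<exists>j<i. xs ! j = v" if "i < length xs" "v < xs ! i" for i v
    using that
  proof (induction i arbitrary: v rule: less_induct)
    case (less i)
    show ?case
    proof (cases "\<exists>j<i. xs ! j = xs ! i")
      case True
      then show ?thesis using less by (metis less_trans)
    next
      case False
      then obtain j where j: "j < i" "xs ! j = xs ! i - 1"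
        using rgf less.prems unfolding rgf_def by (metis gr_zeroI not_less_zero)
      then have "v = xs ! j \<or> v < xs ! j" using less.prems by linarith
      then show ?thesis using j less by (metis less_trans)
    qed
  qed
  then show "xs \<noteq> [] \<and> (\<forall>i<length xs. \<forall>v<xs ! i. \<exists>j<i. xs ! j = v)"
    using rgf unfolding rgf_def by blast
next
  assume small: "xs \<noteq> [] \<and> (\<forall>i<length xs. \<forall>v<xs ! i. \<exists>j<i. xs ! j = v)"
  \<comment> \<open>Nothing precedes position 0, so the letter there has no smaller value.\<close>
  then have "xs ! 0 = 0" by (metis gr_zeroI length_greater_0_conv not_less_zero)
  moreover have "\<exists>j<i. xs ! j = xs ! i - 1" if "i < length xs" "0 < xs ! i" for i
    using small that by simp
  ultimately show "rgf xs" using small unfolding rgf_def by blast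
qed

lemma asc_take:
  assumes "i \<le> length xs"
  shows "asc (take i xs) = card {j. Suc j < i \<and> xs ! j < xs ! Suc j}"
proof -
  have "{j. Suc j < length (take i xs) \<and> take i xs ! j < take i xs ! Suc j} =
      {j. Suc j < i \<and> xs ! j < xs ! Suc j}"
    using assms by auto
  then show ?thesis unfolding asc_def by simp
qed

lemma finite_ascents_below: "finite {j. Suc j < i \<and> xs ! j < xs ! Suc j}"
  by (rule finite_subset[of _ "{..<i}"]) auto

lemma rgf_imp_ascent_seq:
  assumes "rgf xs"
  shows "ascent_seq xs"
proof -
  have small: "\<exists>j<i. xs ! j = v" if "i < length xs" "v < xs ! i" for i v
    using assms that unfolding rgf_iff_smaller_letters_before by blast
  have "xs ! i \<le> asc (take i xs) + 1" if i: "i < length xs" for i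
  proof -
    let ?A = "{j. Suc j < i \<and> xs ! j < xs ! Suc j}"
    \<comment> \<open>Each positive value below \<open>xs ! i\<close> is the top of some ascent
      before \<open>i\<close>, which yields at least \<open>xs ! i - 1\<close> ascents.\<close>
    have "{1..<xs ! i} \<subseteq> (\<lambda>j. xs ! Suc j) ` ?A"
    proof
      fix v assume v: "v \<in> {1..<xs ! i}"
      define p where "p = (LEAST p. p < i \<and> xs ! p = v)"
      have p: "p < i" "xs ! p = v"
        using LeastI_ex[of "\<lambda>p. p < i \<and> xs ! p = v"] small[OF i, of v] v
        unfolding p_def by auto
      have first: "xs ! q \<noteq> v" if "q < p" for q
        using not_less_Least[of q "\<lambda>p. p < i \<and> xs ! p = v"] that p(1) unfolding p_def by auto
      have "p \<noteq> 0" using p v assms unfolding rgf_def by auto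
      then obtain q where q: "p = Suc q" using not0_implies_Suc by blast
      \<comment> \<open>A larger letter just before the first \<open>v\<close> would itself be
        preceded by \<open>v\<close>; an equal one would be an earlier \<open>v\<close>. So
        \<open>p\<close> is an ascent top.\<close>
      have "\<not> v < xs ! q"
        using small[of q v] first p(1) i q by (metis Suc_lessD less_SucI less_trans)
      then have "xs ! q < v" using first[of q] q by auto
      then show "v \<in> (\<lambda>j. xs ! Suc j) ` ?A" using p q by auto
    qed
    then have "card {1..<xs ! i} \<le> card ?A"
      by (rule surj_card_le[OF finite_ascents_below])
    then show ?thesis using asc_take[of i xs] i by simp
  qed
  then show ?thesis using assms unfolding ascent_seq_def rgf_def by blast
qed

text \<open>Induction on the position \<open>i\<close>: if a value \<open>v < xs ! i\<close> were
  missing before \<open>i\<close>, the prefix would have too few ascents to allow a letter above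
  \<open>v\<close>.\<close>

lemma ascent_seq_avoids_0101_imp_rgf:
  assumes seq: "ascent_seq xs" and av: "avoids xs [0,1,0,1]"
  shows "rgf xs"
proof -
  have "\<exists>j<i. xs ! j = v" if "i < length xs" "v < xs ! i" for i v
    using that
  proof (induction i arbitrary: v rule: less_induct)
    case (less i)
    show ?case
    proof (rule ccontr)
      assume new: "\<not> (\<exists>j<i. xs ! j = v)"
      let ?A = "{j. Suc j < i \<and> xs ! j < xs ! Suc j}"
      have "i \<noteq> 0" using less.prems seq unfolding ascent_seq_def by (metis not_less_zero)
      then have "v \<noteq> 0" using new seq unfolding ascent_seq_def by auto
      \<comment> \<open>By the induction hypothesis a letter above \<open>v\<close> would be
        preceded by \<open>v\<close>, which is missing.\<close>
      have below: "xs ! j < v" if "j < i" for j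
        using less.IH[of j v] less.prems(1) new that by (metis less_trans linorder_neqE_nat)
      \<comment> \<open>If two ascents share a top, the bottom of the later one is smaller than this
        top, so by the induction hypothesis it already occurs at some \<open>h\<close> before the
        first top. Positions \<open>h\<close>, \<open>Suc j\<close>, \<open>k\<close>,
        \<open>Suc k\<close> then read 0101.\<close>
      have no_repeat: False
        if asc: "j \<in> ?A" "k \<in> ?A" "j < k" "xs ! Suc j = xs ! Suc k" for j k
      proof -
        have jk: "Suc k < i" "xs ! j < xs ! Suc j" "xs ! k < xs ! Suc j"
          using asc by auto
        then have "Suc j < k" using asc(3) by (cases "Suc j = k") auto
        moreover obtain h where "h < Suc j" "xs ! h = xs ! k"
          using less.IH[of "Suc j" "xs ! k"] jk asc(3) less.prems(1) by auto
        moreover have "Suc k < length xs" using jk(1) less.prems(1) by simp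
        ultimately show False
          using av jk(3) asc(4) unfolding avoids_0101_iff by (metis lessI)
      qed
      have "inj_on (\<lambda>j. xs ! Suc j) ?A"
        using no_repeat by (intro linorder_inj_onI') blast+
      moreover have "(\<lambda>j. xs ! Suc j) ` ?A \<subseteq> {1..<v}"
        using below by auto
      \<comment> \<open>There are at most \<open>v - 1\<close> ascents, so the ascent condition
        gives \<open>xs ! i \<le> v\<close>; \<open>v \<noteq> 0\<close> makes the subtraction
        exact.\<close>
      ultimately have "card ?A \<le> card {1..<v}"
        by (intro card_inj_on_le) auto
      moreover have "xs ! i \<le> card ?A + 1"
        using seq less.prems(1) \<open>i \<noteq> 0\<close> asc_take[of i xs] unfolding ascent_seq_def by auto
      ultimately show False using less.prems(2) \<open>v \<noteq> 0\<close> by simp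
    qed
  qed
  then show ?thesis
    using seq unfolding rgf_iff_smaller_letters_before ascent_seq_def by blast
qed

lemma avoids_101_imp_avoids_0101: "avoids xs [1,0,1] \<Longrightarrow> avoids xs [0,1,0,1]"
  unfolding avoids_101_iff avoids_0101_iff by metis

lemma rgf_avoids_0101_imp_avoids_101:
  assumes "rgf xs" "avoids xs [0,1,0,1]"
  shows "avoids xs [1,0,1]"
  unfolding avoids_101_iff
proof (intro notI, elim exE conjE)
  fix i j k
  assume ijk: "i < j" "j < k" "k < length xs" "xs ! j < xs ! i" "xs ! k = xs ! i"
  then obtain h where "h < i" "xs ! h = xs ! j"
    using assms(1) unfolding rgf_iff_smaller_letters_before by (meson less_trans)
  then show False using assms(2) ijk unfolding avoids_0101_iff by metis
qed

section \<open>Encoding of partitions\<close>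

definition block_of :: "nat set set \<Rightarrow> nat \<Rightarrow> nat set" where
  "block_of P i = (THE B. B \<in> P \<and> i \<in> B)"

lemma block_of_eq:
  assumes "partition_on A P" "B \<in> P" "i \<in> B"
  shows "block_of P i = B"
  unfolding block_of_def
  using assms partition_onD2[OF assms(1)] by (intro the_equality) (auto dest: disjointD)

lemma length_encode [simp]: "length (encode n P) = n"
  by (simp add: encode_def)

lemma nth_encode:
  assumes "i < n"
  shows "encode n P ! i = block_number P (block_of P (Suc i))"
  using assms by (simp add: encode_def block_of_def del: upt_Suc)

section \<open>Block numbers and letters for a fixed partition of \<open>{1..n}\<close>\<close>

context
  fixes n :: nat and P :: "nat set set"
  assumes part: "partition_on {1..n} P"
begin

lemma finite_partition: "finite P"
  by (rule finite_elements[OF _ part]) simp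

lemma Min_block:
  assumes "B \<in> P"
  shows "Min B \<in> B" "i \<in> B \<Longrightarrow> Min B \<le> i"
proof -
  have "B \<subseteq> {1..n}" using part assms by (auto simp: partition_on_def)
  then have "finite B" by (rule finite_subset) simp
  moreover have "B \<noteq> {}" using part assms by (auto simp: partition_on_def)
  ultimately show "Min B \<in> B" "i \<in> B \<Longrightarrow> Min B \<le> i" by auto
qed

lemma block_subset: "B \<in> P \<Longrightarrow> i \<in> B \<Longrightarrow> 1 \<le> i \<and> i \<le> n"
  using part by (auto simp: partition_on_def)

text \<open>Every block counted for \<open>B\<close> is counted for \<open>C\<close>, and
  \<open>B\<close> itself is counted only for \<open>C\<close>.\<close>

lemma block_number_less:
  assumes "B \<in> P" "C \<in> P" "Min B < Min C"
  shows "block_number P B < block_number P C"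
  unfolding block_number_def
  using assms finite_partition by (intro psubset_card_mono) auto

lemma block_number_less_iff:
  assumes "B \<in> P" "C \<in> P"
  shows "block_number P B < block_number P C \<longleftrightarrow> Min B < Min C"
proof
  assume less: "block_number P B < block_number P C"
  show "Min B < Min C"
  proof (rule ccontr)
    assume "\<not> Min B < Min C"
    then have "{D \<in> P. Min D < Min C} \<subseteq> {D \<in> P. Min D < Min B}" by auto
    then have "block_number P C \<le> block_number P B"
      unfolding block_number_def using finite_partition by (intro card_mono) auto
    then show False using less by simp
  qed
qed (rule block_number_less[OF assms])

text \<open>Equal numbers force equal minima, and a common minimum is a common element of two
  blocks.\<close>

lemma inj_on_block_number: "inj_on (block_number P) P"
proof (rule inj_onI)
  fix B C assume BC: "B \<in> P" "C \<in> P" "block_number P B = block_number P C"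
  then have "Min B = Min C"
    using block_number_less_iff by (metis less_irrefl linorder_neqE_nat)
  then have "B \<inter> C \<noteq> {}" using Min_block(1) BC by (metis disjoint_iff)
  then show "B = C" using BC partition_onD2[OF part] by (auto dest: disjointD)
qed

text \<open>Block numbers have no gaps: the blocks with a smaller minimum than \<open>B\<close> are
  mapped injectively into the \<open>block_number P B\<close> many values below, and there are
  exactly that many of them.\<close>

lemma obtain_smaller_block:
  assumes "B \<in> P" "v < block_number P B"
  obtains C where "C \<in> P" "block_number P C = v" "Min C < Min B"
proof -
  let ?L = "{C \<in> P. Min C < Min B}"
  have "inj_on (block_number P) ?L"
    using inj_on_block_number by (rule inj_on_subset) auto
  then have "card (block_number P ` ?L) = block_number P B"
    by (simp add: card_image block_number_def[of P B])
  moreover have "block_number P ` ?L \<subseteq> {..<block_number P B}"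
    using assms(1) block_number_less by auto
  ultimately have "block_number P ` ?L = {..<block_number P B}"
    by (intro card_subset_eq) auto
  then show thesis using assms(2) that by (metis (no_types, lifting) image_iff lessThan_iff mem_Collect_eq)
qed

lemma obtain_block:
  assumes "i < n"
  obtains B where "B \<in> P" "Suc i \<in> B" "encode n P ! i = block_number P B"
proof -
  have "Suc i \<in> \<Union> P" using part assms by (auto simp: partition_on_def)
  then obtain B where "B \<in> P" "Suc i \<in> B" by blast
  then show thesis using that nth_encode[OF assms] block_of_eq[OF part] by metis
qed

text \<open>Elements are counted from 1 and list positions from 0. Blocks lie in
  \<open>{1..n}\<close>, so the truncated subtraction \<open>i - 1\<close> is exact.\<close>

lemma encode_nth_block:
  assumes "B \<in> P" "i \<in> B"
  shows "encode n P ! (i - 1) = block_number P B" "i - 1 < n"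
proof -
  have i: "1 \<le> i" "i \<le> n" using block_subset[OF assms] by auto
  then show "i - 1 < n" by simp
  then show "encode n P ! (i - 1) = block_number P B"
    using i block_of_eq[OF part assms] nth_encode[of "i - 1" n P] by simp
qed

lemma block_eq_encode:
  assumes "B \<in> P"
  shows "B = {i \<in> {1..n}. encode n P ! (i - 1) = block_number P B}"
proof
  show "B \<subseteq> {i \<in> {1..n}. encode n P ! (i - 1) = block_number P B}"
    using encode_nth_block(1)[OF assms] block_subset[OF assms] by auto
  show "{i \<in> {1..n}. encode n P ! (i - 1) = block_number P B} \<subseteq> B"
  proof
    fix i assume i: "i \<in> {i \<in> {1..n}. encode n P ! (i - 1) = block_number P B}"
    then have "i - 1 < n" "Suc (i - 1) = i" by auto
    then obtain C where "C \<in> P" "i \<in> C" "encode n P ! (i - 1) = block_number P C"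
      by (metis obtain_block)
    then show "i \<in> B" using i assms inj_on_block_number by (auto dest: inj_onD)
  qed
qed

text \<open>The right-hand side depends on \<open>P\<close> only through its encoding; this is what
  makes the encoding injective.\<close>

lemma partition_eq_encode:
  "P = (\<lambda>v. {i \<in> {1..n}. encode n P ! (i - 1) = v}) ` set (encode n P)"
proof -
  have "set (encode n P) = block_number P ` P"
  proof
    show "set (encode n P) \<subseteq> block_number P ` P"
      by (auto simp: in_set_conv_nth) (metis obtain_block image_eqI)
    show "block_number P ` P \<subseteq> set (encode n P)"
      using encode_nth_block Min_block(1) by (auto simp: in_set_conv_nth) metis
  qed
  then show ?thesis
    using block_eq_encode by (simp add: image_image)
qed

lemma smaller_letter_before_encode:
  assumes "i < n" "v < encode n P ! i"
  shows "\<exists>j<i. encode n P ! j = v"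
proof -
  obtain B where B: "B \<in> P" "Suc i \<in> B" "encode n P ! i = block_number P B"
    using obtain_block assms(1) by blast
  then obtain C where C: "C \<in> P" "block_number P C = v" "Min C < Min B"
    using obtain_smaller_block assms(2) by metis
  \<comment> \<open>\<open>Min C < Min B \<le> Suc i\<close> and \<open>Min C \<ge> 1\<close>, so
    the position of the minimum of \<open>C\<close> lies strictly before \<open>i\<close>.\<close>
  have "Min C - 1 < i"
    using C(3) Min_block(2)[OF B(1,2)] block_subset[OF C(1) Min_block(1)[OF C(1)]] by linarith
  then show ?thesis using encode_nth_block(1)[OF C(1) Min_block(1)[OF C(1)]] C(2) by blast
qed

lemma rgf_encode: "n \<ge> 1 \<Longrightarrow> rgf (encode n P)"
  using smaller_letter_before_encode
  by (auto simp: rgf_iff_smaller_letters_before simp flip: length_greater_0_conv)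

lemma noncrossing_iff_encode_avoids_0101:
  "noncrossing P \<longleftrightarrow> avoids (encode n P) [0,1,0,1]"
proof
  assume nc: "noncrossing P"
  show "avoids (encode n P) [0,1,0,1]"
    unfolding avoids_0101_iff length_encode
  proof (intro notI, elim exE conjE)
    fix i j k l
    assume ord: "i < j" "j < k" "k < l" "l < n"
      and pat: "encode n P ! i < encode n P ! j" "encode n P ! k = encode n P ! i"
        "encode n P ! l = encode n P ! j"
    \<comment> \<open>Positions with equal letters belong to the same block, so the pattern can be
      read off as block membership.\<close>
    have mem: "Suc m \<in> B" if "B \<in> P" "m < n" "encode n P ! m = block_number P B" for m B
      by (subst block_eq_encode[OF that(1)]) (use that in auto)
    have "i < n" "j < n" using ord by auto
    obtain B where B: "B \<in> P" "Suc i \<in> B" "encode n P ! i = block_number P B"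
      using obtain_block[OF \<open>i < n\<close>] by blast
    obtain C where C: "C \<in> P" "Suc j \<in> C" "encode n P ! j = block_number P C"
      using obtain_block[OF \<open>j < n\<close>] by blast
    have "Suc k \<in> B" "Suc l \<in> C" using mem B C pat ord by auto
    moreover have "B \<noteq> C" using pat B C by auto
    ultimately show False
      using nc B C ord unfolding noncrossing_def by (meson Suc_mono)
  qed
next
  assume av: "avoids (encode n P) [0,1,0,1]"
  show "noncrossing P"
    unfolding noncrossing_def
  proof (intro notI, elim bexE exE conjE)
    fix B C a b c d
    assume BC: "B \<in> P" "C \<in> P" "B \<noteq> C"
      and ord: "a < b" "b < c" "c < d" and mem: "a \<in> B" "c \<in> B" "b \<in> C" "d \<in> C"
    let ?e = "\<lambda>i. encode n P ! (i - 1)"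
    have val: "?e a = block_number P B" "?e c = block_number P B"
      "?e b = block_number P C" "?e d = block_number P C"
      using encode_nth_block(1) BC mem by auto
    have "1 \<le> a" "d \<le> n" using block_subset BC mem by auto
    then have ord': "a - 1 < b - 1" "b - 1 < c - 1" "c - 1 < d - 1" "d - 1 < n"
      using ord by auto
    have "block_number P B \<noteq> block_number P C"
      using BC inj_on_block_number by (auto dest: inj_onD)
    then consider "block_number P B < block_number P C" | "block_number P C < block_number P B"
      by linarith
    then show False
    proof cases
      case 1
      then show False using av ord' val unfolding avoids_0101_iff length_encode by metis
    next
      case 2
      then obtain h where "h < a - 1" "encode n P ! h = block_number P C"
        \<comment> \<open>The positions \<open>h\<close>, \<open>a - 1\<close>,
          \<open>b - 1\<close>, \<open>c - 1\<close> read 0101, with the letter of \<open>C\<close>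
          as 0 and that of \<open>B\<close> as 1.\<close>
        using smaller_letter_before_encode[of "a - 1" "block_number P C"] ord' val by auto
      moreover have "c - 1 < n" using ord' by linarith
      ultimately show False
        using 2 av ord' val unfolding avoids_0101_iff length_encode by metis
    qed
  qed
qed

end

section \<open>Injectivity and image of the encoding\<close>

lemma inj_on_encode: "inj_on (encode n) {P. partition_on {1..n} P}"
  by (rule inj_onI) (metis mem_Collect_eq partition_eq_encode)

text \<open>The blocks are the sets of positions carrying a common letter. Since smaller letters
  appear first earlier, ordering the blocks by minima is ordering them by letters, and the numbering
  returns each letter.\<close>

lemma rgf_obtain_partition:
  assumes rgf: "rgf xs" and len: "length xs = n"
  obtains P where "partition_on {1..n} P" "encode n P = xs"
proof
  define block where "block v = {i \<in> {1..n}. xs ! (i - 1) = v}" for v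
  define P where "P = block ` set xs"
  have small: "\<exists>j<i. xs ! j = v" if "i < n" "v < xs ! i" for i v
    using rgf that len unfolding rgf_iff_smaller_letters_before by blast
  have nonempty: "block v \<noteq> {}" if v: "v \<in> set xs" for v
  proof -
    obtain i where "i < n" "xs ! i = v" using v len by (metis in_set_conv_nth)
    then have "Suc i \<in> block v" by (auto simp: block_def)
    then show ?thesis by blast
  qed
  show part: "partition_on {1..n} P"
  proof (rule partition_onI)
    show "\<Union> P = {1..n}" 
      using len by (fastforce simp: P_def block_def)
    show "disjnt p q" if "p \<in> P" "q \<in> P" "p \<noteq> q" for p q
      using that by (auto simp: P_def block_def disjnt_def)
    show "{} \<notin> P" using nonempty by (auto simp: P_def)
  qed
  have fin: "finite (block v)" for v by (simp add: block_def)
  have Min_less: "Min (block v) < Min (block w)" if vw: "v < w" "w \<in> set xs" for v w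
  proof -
    have "Min (block w) \<in> block w" using fin nonempty[OF vw(2)] by (rule Min_in)
    \<comment> \<open>The minimum of \<open>block w\<close> marks an occurrence of \<open>w\<close>;
      the smaller letter \<open>v\<close> occurs before it and so bounds
      \<open>Min (block v)\<close>.\<close>
    then have m: "Min (block w) - 1 < n" "xs ! (Min (block w) - 1) = w" by (auto simp: block_def)
    then obtain j where j: "j < Min (block w) - 1" "xs ! j = v" using small vw(1) by metis
    then have "Suc j \<in> block v" using m by (auto simp: block_def)
    then have "Min (block v) \<le> Suc j" by (rule Min_le[OF fin])
    then show ?thesis using j by linarith
  qed
  have number: "block_number P (block v) = v" if v: "v \<in> set xs" for v
  proof -
    obtain i where i: "i < n" "xs ! i = v" using v len by (metis in_set_conv_nth)
    have mem: "w \<in> set xs" if "w < v" for w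
      using small[of i w] i that len by (metis less_trans nth_mem)
    \<comment> \<open>All of the values \<open>0, ..., v - 1\<close> occur in \<open>xs\<close>, so
      exactly their blocks have smaller minima; distinct minima make these \<open>v\<close> blocks
      distinct.\<close>
    have "{C \<in> P. Min C < Min (block v)} = block ` {..<v}"
    proof
      show "{C \<in> P. Min C < Min (block v)} \<subseteq> block ` {..<v}"
      proof
        fix C assume "C \<in> {C \<in> P. Min C < Min (block v)}"
        then obtain w where w: "w \<in> set xs" "C = block w" "Min (block w) < Min (block v)"
          unfolding P_def by blast
        then have "w < v" using Min_less[of v w] by (metis less_asym linorder_neqE_nat)
        then show "C \<in> block ` {..<v}" using w by blast
      qed
      show "block ` {..<v} \<subseteq> {C \<in> P. Min C < Min (block v)}"
        using Min_less mem v unfolding P_def by auto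
    qed
    moreover have "inj_on block {..<v}"
      using Min_less mem by (intro linorder_inj_onI') (metis lessThan_iff less_irrefl)
    ultimately show ?thesis by (simp add: block_number_def card_image)
  qed
  show "encode n P = xs"
  proof (rule nth_equalityI)
    fix i assume "i < length (encode n P)"
    then have i: "i < n" by simp
    then have v: "xs ! i \<in> set xs" using len by simp
    then have "block (xs ! i) \<in> P" "Suc i \<in> block (xs ! i)"
      using i by (auto simp: P_def block_def)
    then have "block_of P (Suc i) = block (xs ! i)" by (rule block_of_eq[OF part])
    then show "encode n P ! i = xs ! i" using nth_encode[OF i] number[OF v] by simp
  qed (simp add: len)
qed

text \<open>Encodings are restricted growth functions and hence ascent sequences. Conversely,
  avoidance makes an ascent sequence a restricted growth function, which therefore encodes a
  partition. The crossing criterion matches the remaining conditions in both directions.\<close>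

lemma encode_image_noncrossing_partitions:
  assumes "n \<ge> 1"
  shows "encode n ` noncrossing_partitions n =
    {xs. ascent_seq xs \<and> length xs = n \<and> avoids xs [0,1,0,1]}"
proof
  show "encode n ` noncrossing_partitions n \<subseteq>
      {xs. ascent_seq xs \<and> length xs = n \<and> avoids xs [0,1,0,1]}"
    using rgf_imp_ascent_seq rgf_encode[OF _ assms] noncrossing_iff_encode_avoids_0101
    unfolding noncrossing_partitions_def by auto
  show "{xs. ascent_seq xs \<and> length xs = n \<and> avoids xs [0,1,0,1]} \<subseteq>
      encode n ` noncrossing_partitions n"
  proof
    fix xs assume xs: "xs \<in> {xs. ascent_seq xs \<and> length xs = n \<and> avoids xs [0,1,0,1]}"
    then have "rgf xs" using ascent_seq_avoids_0101_imp_rgf by simp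
    then obtain P where "partition_on {1..n} P" "encode n P = xs"
      using rgf_obtain_partition xs by auto
    then show "xs \<in> encode n ` noncrossing_partitions n"
      using xs noncrossing_iff_encode_avoids_0101 unfolding noncrossing_partitions_def by auto
  qed
qed

theorem theorem2p6:
  shows "(\<forall>xs. ascent_seq xs \<longrightarrow> (avoids xs [0,1,0,1] \<longleftrightarrow> avoids xs [1,0,1])) \<and>
    (\<forall>xs. ascent_seq xs \<and> avoids xs [0,1,0,1] \<longrightarrow> rgf xs) \<and>
    (\<forall>n\<ge>1.
       {xs. ascent_seq xs \<and> length xs = n \<and> avoids xs [0,1,0,1]} =
         {xs. rgf xs \<and> length xs = n \<and> (\<exists>P \<in> noncrossing_partitions n. encode n P = xs)} \<and>
       bij_betw (encode n) (noncrossing_partitions n)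
         {xs. ascent_seq xs \<and> length xs = n \<and> avoids xs [0,1,0,1]})"
proof (intro conjI allI impI)
  fix xs assume "ascent_seq xs"
  then show "avoids xs [0,1,0,1] \<longleftrightarrow> avoids xs [1,0,1]"
    using ascent_seq_avoids_0101_imp_rgf avoids_101_imp_avoids_0101
      rgf_avoids_0101_imp_avoids_101 by blast
next
  fix xs assume "ascent_seq xs \<and> avoids xs [0,1,0,1]"
  then show "rgf xs" using ascent_seq_avoids_0101_imp_rgf by blast
next
  fix n :: nat assume n: "1 \<le> n"
  show "{xs. ascent_seq xs \<and> length xs = n \<and> avoids xs [0,1,0,1]} =
      {xs. rgf xs \<and> length xs = n \<and> (\<exists>P \<in> noncrossing_partitions n. encode n P = xs)}"
    (is "?S = _")
  proof -
    \<comment> \<open>The two sets agree up to the \<open>rgf\<close> and length conditions, which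
      hold for every element of \<open>?S\<close>.\<close>
    have "xs \<in> ?S \<longleftrightarrow> (\<exists>P \<in> noncrossing_partitions n. encode n P = xs)" for xs
      unfolding encode_image_noncrossing_partitions[OF n, symmetric] by blast
    then show ?thesis using ascent_seq_avoids_0101_imp_rgf by auto
  qed
  have "inj_on (encode n) (noncrossing_partitions n)"
    using inj_on_encode by (rule inj_on_subset) (auto simp: noncrossing_partitions_def)
  then show "bij_betw (encode n) (noncrossing_partitions n)
      {xs. ascent_seq xs \<and> length xs = n \<and> avoids xs [0,1,0,1]}"
    using encode_image_noncrossing_partitions[OF n] unfolding bij_betw_def by blast
qed

end
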